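(* Let $A$ be a semiring, let $B$ be a non-empty subset of $A$ and let $n\ge 2$ be an integer. Then: (1) The partially ordered set $(\mathcal{E}_p(2^{A\supset B})_n,\subset)$ (ordered by inclusion) contains maximal elements. (2) $\mathcal{E}_p(2^{A\supset B})_n\cap\mathcal{F}_{ue}(A)_n\neq\emptyset$. Moreover, an element $D\in\mathcal{E}_p(2^{A\supset B})_n$ is maximal (with respect to inclusion in $\mathcal{E}_p(2^{A\supset B})_n$) if and only if $D\in\mathcal{E}_p(2^{A\supset B})_n\cap\mathcal{F}_{ue}(A)_n$.
   Context: A semiring $(A,+,\cdot)$ is associative, with a zero element $0$; multiplication need not be commutative and a multiplicative identity $1$ need not exist (if $1\in A$ then $0\ne 1$). For a non-empty $C\subset A$ and $n\ge 1$, $nC=\{c_1+\cdots+c_n: c_1,\dots,c_n\in C\}$ is the $n$-fold sumset. For non-empty subsets $B,C\subset A$ and $n\ge 2$, write $B\gtrdot\Rightarrow_n C$ if $B\supset C$, $nB=nC$, and the following property holds: (FP) for every $b\in B$ there are $k\ge1$ and $c_1,\dots,c_k\in C$ with $b=c_1\cdots c_k$. For non-empty $B\subset A$, $\mathcal{E}_p(2^{A\supset B})_n=\{D\subset A: D\gtrdot\Rightarrow_n B\}$ (it always contains $B$). A non-empty subset $B$ is called $n$-th sum-factor unexpanded if $\mathcal{E}_p(2^{A\supset B})_n=\{B\}$, and $\mathcal{F}_{ue}(A)_n$ denotes the set of all $n$-th sum-factor unexpanded subsets of $A$. *)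

theory Defs
  imports Main
begin

text \<open>
  A semiring is a type of class \<open>semiring_0\<close>: addition is a commutative monoid with
  absorbing zero, multiplication is an associative operation, not necessarily commutative
  and without a required identity. The carrier is the whole type.
\<close>

definition nfold_sumset :: "nat \<Rightarrow> 'a::semiring_0 set \<Rightarrow> 'a set" where
  "nfold_sumset n C = {(\<Sum>i=1..n. c i) | c. \<forall>i\<in>{1..n}. c i \<in> C}"

text \<open>
  The product of a non-empty list, \<open>c\<^sub>1 \<cdots> c\<^sub>k\<close> with \<open>k \<ge> 1\<close>, is written as a fold
  starting from the first factor, since there need not be an identity for
  \<open>prod_list\<close> to start from.
\<close>

definition factor_property :: "'a::semiring_0 set \<Rightarrow> 'a set \<Rightarrow> bool" where
  "factor_property B C \<longleftrightarrow>
     (\<forall>b\<in>B. \<exists>cs. cs \<noteq> [] \<and> set cs \<subseteq> C \<and> b = foldl (*) (hd cs) (tl cs))"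

definition expands :: "nat \<Rightarrow> 'a::semiring_0 set \<Rightarrow> 'a set \<Rightarrow> bool" where
  "expands n B C \<longleftrightarrow>
     B \<noteq> {} \<and> C \<noteq> {} \<and> C \<subseteq> B \<and> nfold_sumset n B = nfold_sumset n C \<and> factor_property B C"

definition expansions :: "nat \<Rightarrow> 'a::semiring_0 set \<Rightarrow> 'a set set" where
  "expansions n B = {D. expands n D B}"

definition unexpanded_sets :: "nat \<Rightarrow> 'a::semiring_0 set set" where
  "unexpanded_sets n = {B. B \<noteq> {} \<and> expansions n B = {B}}"

definition inclusion_maximal :: "'a set set \<Rightarrow> 'a set \<Rightarrow> bool" where
  "inclusion_maximal \<E> D \<longleftrightarrow> D \<in> \<E> \<and> (\<forall>D'\<in>\<E>. D \<subseteq> D' \<longrightarrow> D' = D)"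

end

theory Submission
  imports Defs
begin

text \<open>
  A sum of \<open>n\<close> elements from the union of a chain already has all its summands in one member
  of the chain, so Zorn's lemma applies to the expansions of \<open>B\<close>. The factor property composes,
  so the expansions of an expansion \<open>D\<close> of \<open>B\<close> are exactly the expansions of \<open>B\<close> that
  contain \<open>D\<close>; being unexpanded is therefore the same as being maximal.
\<close>

lemma nfold_sumset_mono: "C \<subseteq> D \<Longrightarrow> nfold_sumset n C \<subseteq> nfold_sumset n D"
  unfolding nfold_sumset_def by blast

lemma foldl_times_left:
  fixes a :: "'a::semigroup_mult"
  shows "foldl (*) (a * b) xs = a * foldl (*) b xs"
  by (induction xs arbitrary: b) (simp_all add: mult.assoc)

text \<open>Concatenating two factorizations multiplies their products. Both lists must be
  non-empty, since the fold starts from the head and an empty product has no value.\<close>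

lemma foldl_times_append:
  fixes xs ys :: "'a::semigroup_mult list"
  assumes "xs \<noteq> []" "ys \<noteq> []"
  shows "foldl (*) (hd (xs @ ys)) (tl (xs @ ys)) =
    foldl (*) (hd xs) (tl xs) * foldl (*) (hd ys) (tl ys)"
  using assms by (cases ys) (auto simp: foldl_times_left)

lemma factor_property_mono: "factor_property B C \<Longrightarrow> C \<subseteq> D \<Longrightarrow> factor_property B D"
  unfolding factor_property_def by (meson order_trans)

lemma factor_property_refl: "factor_property B B"
  unfolding factor_property_def
proof
  fix b assume "b \<in> B"
  then show "\<exists>cs. cs \<noteq> [] \<and> set cs \<subseteq> B \<and> b = foldl (*) (hd cs) (tl cs)"
    by (intro exI[of _ "[b]"]) simp
qed

text \<open>Replacing each factor from \<open>B\<close> by its own factorization over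
  \<open>C\<close> and concatenating the results rewrites the whole product over \<open>C\<close>.
  This substitution is what makes the factor property transitive.\<close>

lemma factor_property_product:
  assumes "factor_property B C" "bs \<noteq> []" "set bs \<subseteq> B"
  obtains cs where "cs \<noteq> []" "set cs \<subseteq> C"
    "foldl (*) (hd bs) (tl bs) = foldl (*) (hd cs) (tl cs)"
proof -
  have "\<exists>cs. cs \<noteq> [] \<and> set cs \<subseteq> C \<and> foldl (*) (hd bs) (tl bs) = foldl (*) (hd cs) (tl cs)"
    using assms(2,3)
  proof (induction bs rule: list_nonempty_induct)
    case (single b)
    then show ?case
      using assms(1) by (auto simp: factor_property_def)
  next
    case (cons b bs)
    from cons.prems assms(1) obtain cs where cs: "cs \<noteq> []" "set cs \<subseteq> C"
        "b = foldl (*) (hd cs) (tl cs)"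
      by (auto simp: factor_property_def)
    from cons obtain ds where ds: "ds \<noteq> []" "set ds \<subseteq> C"
        "foldl (*) (hd bs) (tl bs) = foldl (*) (hd ds) (tl ds)"
      by auto
    have "foldl (*) (hd (b # bs)) (tl (b # bs)) = b * foldl (*) (hd bs) (tl bs)"
      using foldl_times_append[of "[b]" bs] cons.hyps by simp
    also have "\<dots> = foldl (*) (hd (cs @ ds)) (tl (cs @ ds))"
      using foldl_times_append[of cs ds] cs ds by simp
    finally show ?case
      using cs ds by (intro exI[of _ "cs @ ds"]) simp
  qed
  then show thesis using that by blast
qed

lemma factor_property_trans:
  assumes "factor_property A B" "factor_property B C"
  shows "factor_property A C"
  using assms(1) factor_property_product[OF assms(2)] unfolding factor_property_def by metis

lemma expands_refl: "B \<noteq> {} \<Longrightarrow> expands n B B"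
  by (simp add: expands_def factor_property_refl)

lemma expands_trans: "expands n D C \<Longrightarrow> expands n C B \<Longrightarrow> expands n D B"
  unfolding expands_def using factor_property_trans by blast

text \<open>Factors taken from \<open>B\<close> also lie in the larger set \<open>C\<close>, and
  both sumsets equal that of \<open>B\<close>.\<close>

lemma expands_intermediate:
  assumes "expands n D B" "expands n C B" "C \<subseteq> D"
  shows "expands n D C"
  using assms factor_property_mono unfolding expands_def by metis

lemma expansions_of_expansion:
  assumes "D \<in> expansions n B"
  shows "expansions n D = {D' \<in> expansions n B. D \<subseteq> D'}"
proof -
  have "expands n D' D \<longleftrightarrow> expands n D' B \<and> D \<subseteq> D'" for D'
  proof
    have D: "expands n D B"
      using assms by (simp add: expansions_def)
    show "expands n D' B \<and> D \<subseteq> D'" if "expands n D' D"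
      using expands_trans[OF that D] that by (simp add: expands_def)
    show "expands n D' D" if "expands n D' B \<and> D \<subseteq> D'"
      using expands_intermediate[OF _ D] that by simp
  qed
  then show ?thesis by (auto simp: expansions_def)
qed

text \<open>Maximality says that \<open>D\<close> is the only expansion of \<open>B\<close>
  containing \<open>D\<close>, and those expansions are precisely
  \<open>expansions n D\<close>.\<close>

lemma inclusion_maximal_expansions_iff:
  assumes "D \<in> expansions n B"
  shows "inclusion_maximal (expansions n B) D \<longleftrightarrow> D \<in> unexpanded_sets n"
proof -
  have "D \<noteq> {}"
    using assms by (auto simp: expansions_def expands_def)
  then show ?thesis
    using assms expansions_of_expansion[OF assms]
    unfolding inclusion_maximal_def unexpanded_sets_def by auto
qed

text \<open>The finitely many summands lie in finitely many members of the chain, and the largest of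
  these contains them all. The empty chain is excluded because for \<open>n = 0\<close> the left
  side is still \<open>{0}\<close>.\<close>

lemma nfold_sumset_chain_Union:
  assumes "subset.chain \<A> \<C>" "\<C> \<noteq> {}"
  shows "nfold_sumset n (\<Union>\<C>) = (\<Union>C\<in>\<C>. nfold_sumset n C)"
proof
  show "(\<Union>C\<in>\<C>. nfold_sumset n C) \<subseteq> nfold_sumset n (\<Union>\<C>)"
    by (meson UN_least Union_upper nfold_sumset_mono)
  show "nfold_sumset n (\<Union>\<C>) \<subseteq> (\<Union>C\<in>\<C>. nfold_sumset n C)"
  proof
    fix x assume "x \<in> nfold_sumset n (\<Union>\<C>)"
    then obtain c where x: "x = (\<Sum>i=1..n. c i)" and c: "c ` {1..n} \<subseteq> \<Union>\<C>"
      unfolding nfold_sumset_def by blast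
    obtain C where "C \<in> \<C>" "c ` {1..n} \<subseteq> C"
      using finite_subset_Union_chain[OF _ c assms(2,1)] by auto
    with x show "x \<in> (\<Union>C\<in>\<C>. nfold_sumset n C)"
      unfolding nfold_sumset_def by blast
  qed
qed

text \<open>The chain matters only for the sumset; the factor property is checked element by element
  and so passes to any union.\<close>

lemma expansions_chain_Union:
  assumes "subset.chain (expansions n B) \<C>" "\<C> \<noteq> {}"
  shows "\<Union>\<C> \<in> expansions n B"
proof -
  have *: "expands n C B" if "C \<in> \<C>" for C
    using assms(1) that by (auto simp: subset.chain_def expansions_def)
  have "nfold_sumset n (\<Union>\<C>) = nfold_sumset n B"
    using * assms nfold_sumset_chain_Union[OF assms] by (auto simp: expands_def)
  moreover have "factor_property (\<Union>\<C>) B"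
    using * by (auto simp: expands_def factor_property_def)
  ultimately show ?thesis
    using * assms(2) unfolding expansions_def expands_def by blast
qed

lemma ex_inclusion_maximal_expansion:
  assumes "B \<noteq> {}"
  shows "\<exists>D. inclusion_maximal (expansions n B) D"
proof -
  have "expansions n B \<noteq> {}"
    using expands_refl[OF assms] by (auto simp: expansions_def)
  then show ?thesis
    \<comment> \<open>This form of Zorn's lemma asks for unions of non-empty chains only; the empty
      union is not an expansion.\<close>
    using subset_Zorn_nonempty[of "expansions n B"] expansions_chain_Union
    unfolding inclusion_maximal_def by blast
qed

theorem theorem2p7:
  fixes B :: "'a::semiring_0 set" and n :: nat
  assumes one_neq_zero: "\<forall>e::'a. (\<forall>x. e * x = x \<and> x * e = x) \<longrightarrow> 0 \<noteq> e"
    and "B \<noteq> {}" and "n \<ge> 2"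
  shows "(\<exists>D. inclusion_maximal (expansions n B) D) \<and>
    expansions n B \<inter> unexpanded_sets n \<noteq> {} \<and>
    (\<forall>D\<in>expansions n B.
       inclusion_maximal (expansions n B) D \<longleftrightarrow> D \<in> expansions n B \<inter> unexpanded_sets n)"
proof -
  obtain D where D: "inclusion_maximal (expansions n B) D"
    using ex_inclusion_maximal_expansion[OF \<open>B \<noteq> {}\<close>] by blast
  then have "D \<in> expansions n B"
    by (simp add: inclusion_maximal_def)
  \<comment> \<open>The maximal element from Zorn's lemma also witnesses that the intersection is
    non-empty.\<close>
  with D have "D \<in> expansions n B \<inter> unexpanded_sets n"
    using inclusion_maximal_expansions_iff by blast
  with D show ?thesis
    using inclusion_maximal_expansions_iff by blast
qed

end
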